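(* Maximum Weight Connected Matching can be solved in linear time when the input graph is a cycle, with arbitrary (possibly negative) real edge weights.
   Context: An edge-weighted graph is a finite simple undirected graph $G=(V,E)$ with a weight function $w:E\to\mathbb{R}$ (weights may be negative). For a matching $M\subseteq E$, let $V(M)$ be the set of endpoints of edges of $M$, $G[M]=G[V(M)]$, and $w(M)=\sum_{e\in M}w(e)$. A matching $M$ is connected if $G[M]$ is connected (the empty matching is allowed). Maximum Weight Connected Matching: given an edge-weighted graph $G$, find a connected matching $M$ of $G$ with maximum $w(M)$. *)

theory Defs
  imports Complex_Main
begin

section \<open>Graphs and connected matchings\<close>

text \<open>A graph is a pair of a vertex set \<open>V\<close> and a set \<open>E\<close> of two-element subsets of \<open>V\<close>.\<close>

definition simple_graph :: "'a set \<Rightarrow> 'a set set \<Rightarrow> bool" where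
  "simple_graph V E \<longleftrightarrow> finite V \<and> (\<forall>e\<in>E. e \<subseteq> V \<and> card e = 2)"

definition induced_edges :: "'a set set \<Rightarrow> 'a set \<Rightarrow> 'a set set" where
  "induced_edges E S = {e \<in> E. e \<subseteq> S}"

text \<open>The graph without vertices counts as connected, so that the empty matching is a
  connected matching.\<close>

definition connected_graph :: "'a set \<Rightarrow> 'a set set \<Rightarrow> bool" where
  "connected_graph V E \<longleftrightarrow> (\<forall>u\<in>V. \<forall>v\<in>V. (u, v) \<in> {(x, y). {x, y} \<in> E}\<^sup>*)"

definition matching :: "'a set set \<Rightarrow> 'a set set \<Rightarrow> bool" where
  "matching E M \<longleftrightarrow> M \<subseteq> E \<and> (\<forall>e\<in>M. \<forall>f\<in>M. e \<noteq> f \<longrightarrow> e \<inter> f = {})"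

definition connected_matching :: "'a set set \<Rightarrow> 'a set set \<Rightarrow> bool" where
  "connected_matching E M \<longleftrightarrow>
     matching E M \<and> connected_graph (\<Union>M) (induced_edges E (\<Union>M))"

definition max_weight_connected_matching ::
    "'a set set \<Rightarrow> ('a set \<Rightarrow> real) \<Rightarrow> 'a set set \<Rightarrow> bool" where
  "max_weight_connected_matching E w M \<longleftrightarrow>
     connected_matching E M \<and> (\<forall>M'. connected_matching E M' \<longrightarrow> sum w M' \<le> sum w M)"

definition cycle_graph :: "'a set \<Rightarrow> 'a set set \<Rightarrow> bool" where
  "cycle_graph V E \<longleftrightarrow>
     (\<exists>vs. length vs \<ge> 3 \<and> distinct vs \<and> V = set vs \<and>
           E = {{vs ! i, vs ! (Suc i mod length vs)} | i. i < length vs})"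


section \<open>Random access machine programs with real numbers\<close>

text \<open>
  Programs of a unit-cost random access machine, in structured form. Memory consists of
  finitely many named variables and arrays (those occurring in the program) of two sorts:
  machine words, which are natural numbers and the only possible array indices, and real
  numbers. Reals can only be moved, added, subtracted and compared. There is no conversion
  between the sorts (such as rounding) and no real constant other than 0.

  Words are bounded by a number \<open>L\<close>: an execution in which a word (including intermediate
  results and addresses) exceeds \<open>L\<close> does not exist. With \<open>L\<close> linear in the size of the
  input, words have logarithmically many bits, which justifies charging one time unit per
  operation.
\<close>

datatype iexp =
    IConst nat
  | IVar nat
  | IArr nat iexp
  | IAdd iexp iexp
  | ISub iexp iexp
  | IMul iexp iexp
  | IDiv iexp iexp

datatype rexp =
    RZero
  | RVar nat
  | RArr nat iexp
  | RAdd rexp rexp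
  | RSub rexp rexp

datatype bexp =
    ILess iexp iexp
  | RLess rexp rexp
  | BNot bexp
  | BAnd bexp bexp

datatype com =
    Skip
  | IAssign nat iexp
  | IStore nat iexp iexp
  | RAssign nat rexp
  | RStore nat iexp rexp
  | Seq com com
  | Cond bexp com com
  | While bexp com

record state =
  ivar :: "nat \<Rightarrow> nat"
  iarr :: "nat \<Rightarrow> nat \<Rightarrow> nat"
  rvar :: "nat \<Rightarrow> real"
  rarr :: "nat \<Rightarrow> nat \<Rightarrow> real"

text \<open>Values. Subtraction of words is truncated at 0, and division by 0 yields 0.\<close>

primrec ival :: "state \<Rightarrow> iexp \<Rightarrow> nat" where
  "ival s (IConst k) = k"
| "ival s (IVar x) = ivar s x"
| "ival s (IArr a e) = iarr s a (ival s e)"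
| "ival s (IAdd e f) = ival s e + ival s f"
| "ival s (ISub e f) = ival s e - ival s f"
| "ival s (IMul e f) = ival s e * ival s f"
| "ival s (IDiv e f) = ival s e div ival s f"

primrec rval :: "state \<Rightarrow> rexp \<Rightarrow> real" where
  "rval s RZero = 0"
| "rval s (RVar x) = rvar s x"
| "rval s (RArr a e) = rarr s a (ival s e)"
| "rval s (RAdd e f) = rval s e + rval s f"
| "rval s (RSub e f) = rval s e - rval s f"

primrec bval :: "state \<Rightarrow> bexp \<Rightarrow> bool" where
  "bval s (ILess e f) \<longleftrightarrow> ival s e < ival s f"
| "bval s (RLess e f) \<longleftrightarrow> rval s e < rval s f"
| "bval s (BNot b) \<longleftrightarrow> \<not> bval s b"
| "bval s (BAnd b c) \<longleftrightarrow> bval s b \<and> bval s c"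

text \<open>All words arising in the evaluation of an expression are at most \<open>L\<close>.\<close>

primrec ifits :: "nat \<Rightarrow> state \<Rightarrow> iexp \<Rightarrow> bool" where
  "ifits L s (IConst k) \<longleftrightarrow> k \<le> L"
| "ifits L s (IVar x) \<longleftrightarrow> ivar s x \<le> L"
| "ifits L s (IArr a e) \<longleftrightarrow> ifits L s e \<and> iarr s a (ival s e) \<le> L"
| "ifits L s (IAdd e f) \<longleftrightarrow> ifits L s e \<and> ifits L s f \<and> ival s e + ival s f \<le> L"
| "ifits L s (ISub e f) \<longleftrightarrow> ifits L s e \<and> ifits L s f"
| "ifits L s (IMul e f) \<longleftrightarrow> ifits L s e \<and> ifits L s f \<and> ival s e * ival s f \<le> L"
| "ifits L s (IDiv e f) \<longleftrightarrow> ifits L s e \<and> ifits L s f"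

primrec rfits :: "nat \<Rightarrow> state \<Rightarrow> rexp \<Rightarrow> bool" where
  "rfits L s RZero \<longleftrightarrow> True"
| "rfits L s (RVar x) \<longleftrightarrow> True"
| "rfits L s (RArr a e) \<longleftrightarrow> ifits L s e"
| "rfits L s (RAdd e f) \<longleftrightarrow> rfits L s e \<and> rfits L s f"
| "rfits L s (RSub e f) \<longleftrightarrow> rfits L s e \<and> rfits L s f"

primrec bfits :: "nat \<Rightarrow> state \<Rightarrow> bexp \<Rightarrow> bool" where
  "bfits L s (ILess e f) \<longleftrightarrow> ifits L s e \<and> ifits L s f"
| "bfits L s (RLess e f) \<longleftrightarrow> rfits L s e \<and> rfits L s f"
| "bfits L s (BNot b) \<longleftrightarrow> bfits L s b"
| "bfits L s (BAnd b c) \<longleftrightarrow> bfits L s b \<and> bfits L s c"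

text \<open>Evaluating an expression costs one time unit per node of its syntax tree.\<close>

primrec icost :: "iexp \<Rightarrow> nat" where
  "icost (IConst k) = 1"
| "icost (IVar x) = 1"
| "icost (IArr a e) = 1 + icost e"
| "icost (IAdd e f) = 1 + icost e + icost f"
| "icost (ISub e f) = 1 + icost e + icost f"
| "icost (IMul e f) = 1 + icost e + icost f"
| "icost (IDiv e f) = 1 + icost e + icost f"

primrec rcost :: "rexp \<Rightarrow> nat" where
  "rcost RZero = 1"
| "rcost (RVar x) = 1"
| "rcost (RArr a e) = 1 + icost e"
| "rcost (RAdd e f) = 1 + rcost e + rcost f"
| "rcost (RSub e f) = 1 + rcost e + rcost f"

primrec bcost :: "bexp \<Rightarrow> nat" where
  "bcost (ILess e f) = 1 + icost e + icost f"
| "bcost (RLess e f) = 1 + rcost e + rcost f"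
| "bcost (BNot b) = 1 + bcost b"
| "bcost (BAnd b c) = 1 + bcost b + bcost c"

text \<open>\<open>exec L c s t s'\<close>: with word bound \<open>L\<close>, the program \<open>c\<close> started in state \<open>s\<close>
  terminates after exactly \<open>t\<close> time units in state \<open>s'\<close>.\<close>

inductive exec :: "nat \<Rightarrow> com \<Rightarrow> state \<Rightarrow> nat \<Rightarrow> state \<Rightarrow> bool" for L :: nat where
  exec_Skip: "exec L Skip s 1 s"
| exec_IAssign: "ifits L s e \<Longrightarrow>
    exec L (IAssign x e) s (1 + icost e) (s\<lparr>ivar := (ivar s)(x := ival s e)\<rparr>)"
| exec_IStore: "ifits L s i \<Longrightarrow> ifits L s e \<Longrightarrow>
    exec L (IStore a i e) s (1 + icost i + icost e)
      (s\<lparr>iarr := (iarr s)(a := (iarr s a)(ival s i := ival s e))\<rparr>)"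
| exec_RAssign: "rfits L s e \<Longrightarrow>
    exec L (RAssign x e) s (1 + rcost e) (s\<lparr>rvar := (rvar s)(x := rval s e)\<rparr>)"
| exec_RStore: "ifits L s i \<Longrightarrow> rfits L s e \<Longrightarrow>
    exec L (RStore a i e) s (1 + icost i + rcost e)
      (s\<lparr>rarr := (rarr s)(a := (rarr s a)(ival s i := rval s e))\<rparr>)"
| exec_Seq: "exec L c s t s' \<Longrightarrow> exec L d s' t' s'' \<Longrightarrow> exec L (Seq c d) s (t + t') s''"
| exec_CondTrue: "bfits L s b \<Longrightarrow> bval s b \<Longrightarrow> exec L c s t s' \<Longrightarrow>
    exec L (Cond b c d) s (1 + bcost b + t) s'"
| exec_CondFalse: "bfits L s b \<Longrightarrow> \<not> bval s b \<Longrightarrow> exec L d s t s' \<Longrightarrow>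
    exec L (Cond b c d) s (1 + bcost b + t) s'"
| exec_WhileFalse: "bfits L s b \<Longrightarrow> \<not> bval s b \<Longrightarrow> exec L (While b c) s (1 + bcost b) s"
| exec_WhileTrue: "bfits L s b \<Longrightarrow> bval s b \<Longrightarrow> exec L c s t s' \<Longrightarrow>
    exec L (While b c) s' t' s'' \<Longrightarrow> exec L (While b c) s (1 + bcost b + t + t') s''"

inductive_cases exec_SkipE: "exec L Skip s t s'"
inductive_cases exec_IAssignE: "exec L (IAssign x e) s t s'"
inductive_cases exec_IStoreE: "exec L (IStore a i e) s t s'"
inductive_cases exec_RAssignE: "exec L (RAssign x e) s t s'"
inductive_cases exec_RStoreE: "exec L (RStore a i e) s t s'"
inductive_cases exec_SeqE: "exec L (Seq c d) s t s'"
inductive_cases exec_CondE: "exec L (Cond b c d) s t s'"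
inductive_cases exec_WhileE: "exec L (While b c) s t s'"

lemma exec_deterministic:
  "exec L c s t s' \<Longrightarrow> exec L c s u s'' \<Longrightarrow> u = t \<and> s'' = s'"
proof (induction arbitrary: u s'' rule: exec.induct)
  case (exec_Skip s)
  from exec_Skip.prems show ?case by (rule exec_SkipE) simp
next
  case (exec_IAssign s e x)
  from exec_IAssign.prems show ?case by (rule exec_IAssignE) simp
next
  case (exec_IStore s i e a)
  from exec_IStore.prems show ?case by (rule exec_IStoreE) simp
next
  case (exec_RAssign s e x)
  from exec_RAssign.prems show ?case by (rule exec_RAssignE) simp
next
  case (exec_RStore s i e a)
  from exec_RStore.prems show ?case by (rule exec_RStoreE) simp
next
  case (exec_Seq c s t s' d t' s2)
  from exec_Seq.prems show ?case
  proof (rule exec_SeqE)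
    fix t1 s1 t2
    assume u: "u = t1 + t2" and 1: "exec L c s t1 s1" and 2: "exec L d s1 t2 s''"
    from exec_Seq.IH(1)[OF 1] have eq: "t1 = t" "s1 = s'" by auto
    from exec_Seq.IH(2)[of t2 s''] 2 eq u show ?thesis by simp
  qed
next
  case (exec_CondTrue s b c t s' d)
  from exec_CondTrue.prems show ?case
  proof (rule exec_CondE)
    fix t1 assume u: "u = Suc (bcost b + t1)" and 1: "exec L c s t1 s''"
    from exec_CondTrue.IH[OF 1] u show ?thesis by simp
  next
    assume "\<not> bval s b"
    with exec_CondTrue.hyps show ?thesis by simp
  qed
next
  case (exec_CondFalse s b d t s' c)
  from exec_CondFalse.prems show ?case
  proof (rule exec_CondE)
    assume "bval s b"
    with exec_CondFalse.hyps show ?thesis by simp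
  next
    fix t1 assume u: "u = Suc (bcost b + t1)" and 1: "exec L d s t1 s''"
    from exec_CondFalse.IH[OF 1] u show ?thesis by simp
  qed
next
  case (exec_WhileFalse s b c)
  from exec_WhileFalse.prems show ?case
    by (rule exec_WhileE) (use exec_WhileFalse.hyps in simp_all)
next
  case (exec_WhileTrue s b c t s' t' s2)
  from exec_WhileTrue.prems show ?case
  proof (rule exec_WhileE)
    assume "\<not> bval s b"
    with exec_WhileTrue.hyps show ?thesis by simp
  next
    fix t1 s1 t2
    assume u: "u = Suc (bcost b + t1 + t2)"
      and 1: "exec L c s t1 s1" and 2: "exec L (While b c) s1 t2 s''"
    from exec_WhileTrue.IH(1)[OF 1] have eq: "t1 = t" "s1 = s'" by auto
    from exec_WhileTrue.IH(2)[of t2 s''] 2 eq u show ?thesis by simp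
  qed
qed


section \<open>Encoding of inputs and outputs\<close>

text \<open>The edges are listed in arbitrary order, each exactly once and in an arbitrary
  orientation.\<close>

definition edge_list :: "nat set set \<Rightarrow> (nat \<times> nat) list \<Rightarrow> bool" where
  "edge_list E es \<longleftrightarrow>
     distinct (map (\<lambda>(u, v). {u, v}) es) \<and> set (map (\<lambda>(u, v). {u, v}) es) = E"

text \<open>The number of vertices and the number of edges are in the word variables 0 and 1, the
  endpoints of the edges in the word arrays 0 and 1, and the weights of the edges in the real
  array 0. All other memory is zero.\<close>

definition input_state :: "nat \<Rightarrow> (nat \<times> nat) list \<Rightarrow> (nat set \<Rightarrow> real) \<Rightarrow> state" where
  "input_state n es w =
     \<lparr>ivar = (\<lambda>_. 0)(0 := n, 1 := length es),
      iarr = (\<lambda>_ _. 0)(0 := (\<lambda>i. if i < length es then fst (es ! i) else 0),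
                      1 := (\<lambda>i. if i < length es then snd (es ! i) else 0)),
      rvar = (\<lambda>_. 0),
      rarr = (\<lambda>_ _. 0)(0 := (\<lambda>i. if i < length es then w {fst (es ! i), snd (es ! i)} else 0))\<rparr>"

text \<open>The resulting edge set is read off from the word array 2: the edge at position \<open>i\<close> of
  the input is selected iff the \<open>i\<close>-th entry is 1.\<close>

definition output_edges :: "(nat \<times> nat) list \<Rightarrow> state \<Rightarrow> nat set set" where
  "output_edges es s = {{fst (es ! i), snd (es ! i)} | i. i < length es \<and> iarr s 2 i = 1}"

end

theory Submission
  imports Defs "HOL-Number_Theory.Cong"
begin

text \<open>
  Number the vertices \<open>x 0, x 1, \<dots>\<close> along the cycle, periodically, and let \<open>edge i\<close> join
  \<open>x i\<close> and \<open>x (i + 1)\<close>. The connected matchings are exactly the alternating chains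
  \<open>edge i, edge (i + 2), \<dots>, edge (i + 2k - 2)\<close> with \<open>2k \<le> n\<close>. With prefix weights
  \<open>q (i + 2) = q i + w (edge i)\<close> such a chain weighs \<open>q (i + 2k) - q i\<close>, so one has to maximise
  \<open>q j - q i\<close> over \<open>i \<le> j \<le> i + H\<close> with \<open>j - i\<close> even, where \<open>H\<close> is the largest even number
  with \<open>H \<le> n\<close>. Starts \<open>i \<le> H\<close> suffice. If \<open>j \<le> H\<close>, the length bound is void and the best
  \<open>i\<close> is a prefix argmin of \<open>q\<close> within its parity class; if \<open>j > H\<close>, the constraint is
  \<open>j - H \<le> i \<le> H\<close> and the best \<open>i\<close> is a suffix argmin. Both cases take linear time.
\<close>

section \<open>Connected matchings of a cycle\<close>

locale cyclic_walk =
  fixes n :: nat and x :: "nat \<Rightarrow> 'a" and E :: "'a set set"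
  assumes n_ge_3: "n \<ge> 3"
    and x_eq_iff: "x i = x j \<longleftrightarrow> [i = j] (mod n)"
    and E_eq: "E = range (\<lambda>i. {x i, x (Suc i)})"
begin

definition edge :: "nat \<Rightarrow> 'a set" where
  "edge i = {x i, x (Suc i)}"

definition chain :: "nat \<Rightarrow> nat \<Rightarrow> 'a set set" where
  "chain i k = (\<lambda>j. edge (i + 2 * j)) ` {..<k}"

lemma x_add_cancel: "s < n \<Longrightarrow> t < n \<Longrightarrow> x (i + s) = x (i + t) \<longleftrightarrow> s = t"
  by (simp add: x_eq_iff cong_add_lcancel_nat) (simp add: cong_def)

lemma x_period: "x (k + n) = x k"
  by (simp add: x_eq_iff cong_def)

lemma edge_mod: "edge (k mod n) = edge k"
  by (auto simp: edge_def x_eq_iff cong_def mod_Suc_eq)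

lemma edge_in: "edge i \<in> E"
  by (auto simp: E_eq edge_def)

lemma x_Suc_in_edge_iff: "x (Suc m) \<in> edge i \<longleftrightarrow> [i = m] (mod n) \<or> [i = Suc m] (mod n)"
  using cong_add_rcancel_nat[of i 1 m n]
  by (auto simp: edge_def x_eq_iff cong_sym_eq)

lemma edge_cong: "[i = j] (mod n) \<Longrightarrow> edge i = edge j"
  by (metis edge_mod cong_def)

lemma incident_edge:
  assumes "e \<in> E" "x (Suc m) \<in> e"
  shows "e = edge m \<or> e = edge (Suc m)"
proof -
  obtain i where "e = edge i"
    using assms(1) by (auto simp: E_eq edge_def)
  then show ?thesis
    using assms(2) edge_cong by (auto simp: x_Suc_in_edge_iff)
qed

text \<open>This relies on \<open>n \<ge> 3\<close>: on a closed walk of length 2 both edges would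
  join the same two vertices.\<close>

lemma edge_neq_Suc: "edge m \<noteq> edge (Suc m)"
  using x_add_cancel[of 0 2 m] x_add_cancel[of 0 1 m] n_ge_3
  by (auto simp: edge_def doubleton_eq_iff)

text \<open>Equal edges with non-congruent indices would be traversed in opposite directions,
  forcing \<open>x (j + 2) = x j\<close>, which \<open>n \<ge> 3\<close> excludes.\<close>

lemma edge_eq_iff: "edge i = edge j \<longleftrightarrow> [i = j] (mod n)"
proof
  assume eq: "edge i = edge j"
  show "[i = j] (mod n)"
  proof (rule ccontr)
    assume "\<not> [i = j] (mod n)"
    then have "x i = x (Suc j)" "x (Suc i) = x j"
      using eq by (auto simp: edge_def doubleton_eq_iff x_eq_iff)
    then have "x (Suc (Suc j)) = x j"
      by (metis Suc_eq_plus1 cong_add_rcancel_nat x_eq_iff)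
    then show False
      using x_add_cancel[of 0 2 j] n_ge_3 by auto
  qed
qed (rule edge_cong)

section \<open>Chains as connected matchings\<close>

lemma Union_chain: "\<Union>(chain i k) = (\<lambda>t. x (i + t)) ` {..<2 * k}"
proof
  show "\<Union>(chain i k) \<subseteq> (\<lambda>t. x (i + t)) ` {..<2 * k}"
  proof
    fix v assume "v \<in> \<Union>(chain i k)"
    then obtain j where j: "j < k" "v = x (i + 2 * j) \<or> v = x (i + Suc (2 * j))"
      by (auto simp: chain_def edge_def)
    moreover have "2 * j < 2 * k" "Suc (2 * j) < 2 * k" using j by auto
    ultimately show "v \<in> (\<lambda>t. x (i + t)) ` {..<2 * k}"
      by blast
  qed
next
  show "(\<lambda>t. x (i + t)) ` {..<2 * k} \<subseteq> \<Union>(chain i k)"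
  proof clarify
    fix t assume t: "t < 2 * k"
    have "t = 2 * (t div 2) \<or> t = Suc (2 * (t div 2))" by presburger
    then have "x (i + t) \<in> edge (i + 2 * (t div 2))"
      unfolding edge_def by (metis add_Suc_right insertCI)
    moreover have "t div 2 < k" using t by auto
    ultimately show "x (i + t) \<in> \<Union>(chain i k)"
      by (auto simp: chain_def)
  qed
qed

text \<open>The four endpoints have distinct offsets below \<open>n\<close>, where the walk is
  injective.\<close>

lemma edge_disjoint:
  assumes "s < k" "t < k" "2 * k \<le> n" "s \<noteq> t"
  shows "edge (i + 2 * s) \<inter> edge (i + 2 * t) = {}"
proof -
  have "2 * s \<noteq> Suc (2 * t)" "2 * t \<noteq> Suc (2 * s)" by presburger+
  then show ?thesis
    using assms x_add_cancel[of "2 * s" "2 * t" i] x_add_cancel[of "2 * s" "Suc (2 * t)" i]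
      x_add_cancel[of "Suc (2 * s)" "2 * t" i] x_add_cancel[of "Suc (2 * s)" "Suc (2 * t)" i]
    by (auto simp: edge_def)
qed

lemma inj_on_chain:
  assumes "2 * k \<le> n"
  shows "inj_on (\<lambda>j. edge (i + 2 * j)) {..<k}"
proof (rule inj_onI, rule ccontr)
  fix s t assume "s \<in> {..<k}" "t \<in> {..<k}" and eq: "edge (i + 2 * s) = edge (i + 2 * t)" and "s \<noteq> t"
  then have "edge (i + 2 * s) \<inter> edge (i + 2 * t) = {}"
    using edge_disjoint[of s k t i] assms by auto
  then show False using eq by (auto simp: edge_def)
qed

lemma sum_chain:
  "2 * k \<le> n \<Longrightarrow> sum w (chain i k) = (\<Sum>j<k. w (edge (i + 2 * j)))"
  by (simp add: chain_def sum.reindex inj_on_chain)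

text \<open>All vertices of the arc are reached from \<open>x i\<close> along consecutive edges;
  those linking two matching edges are in the induced graph, though not in the chain.\<close>

lemma connected_matching_chain:
  assumes k: "2 * k \<le> n"
  shows "connected_matching E (chain i k)"
proof -
  have m: "matching E (chain i k)"
    unfolding matching_def
  proof (intro conjI ballI impI)
    show "chain i k \<subseteq> E" using edge_in by (auto simp: chain_def)
  next
    fix e f assume "e \<in> chain i k" "f \<in> chain i k" "e \<noteq> f"
    then show "e \<inter> f = {}"
      using edge_disjoint[of _ k _ i] k by (fastforce simp: chain_def)
  qed
  let ?S = "(\<lambda>t. x (i + t)) ` {..<2 * k}"
  let ?R = "{(y, z). {y, z} \<in> induced_edges E ?S}"
  have step: "(x (i + t), x (i + Suc t)) \<in> ?R" if "Suc t < 2 * k" for t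
  proof -
    have "x (i + t) \<in> ?S" "x (i + Suc t) \<in> ?S" using that by (blast intro: Suc_lessD)+
    then show ?thesis using edge_in[of "i + t"] by (simp add: induced_edges_def edge_def)
  qed
  have reach: "(x i, x (i + t)) \<in> ?R\<^sup>*" if "t < 2 * k" for t
    using that
  proof (induction t)
    case (Suc t)
    then show ?case using step[of t] by (meson Suc_lessD rtrancl.rtrancl_into_rtrancl)
  qed simp
  have "sym ?R" by (auto simp: sym_def insert_commute)
  then have "sym (?R\<^sup>*)" by (rule sym_rtrancl)
  then have "(x (i + s), x (i + t)) \<in> ?R\<^sup>*" if "s < 2 * k" "t < 2 * k" for s t
    using reach[OF that(1)] reach[OF that(2)] by (meson rtrancl_trans symD)
  then have "connected_graph ?S (induced_edges E ?S)"
    unfolding connected_graph_def by blast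
  with m show ?thesis by (simp add: connected_matching_def Union_chain)
qed

section \<open>Connected matchings as chains\<close>

lemma shifted_edge:
  assumes "e \<in> E"
  obtains t where "t < n" "e = edge (i + t)"
proof -
  obtain m where m: "e = edge m" using assms by (auto simp: E_eq edge_def)
  \<comment> \<open>Modulo \<open>n\<close>, \<open>(n - 1) * i\<close> stands for
    \<open>- i\<close>, so \<open>?t\<close> is the offset of \<open>m\<close> from
    \<open>i\<close>.\<close>
  let ?t = "(m + (n - 1) * i) mod n"
  have "n * i = (n - 1) * i + i"
    using n_ge_3 by (simp add: algebra_simps)
  then have "i + (m + (n - 1) * i) = m + n * i" by linarith
  then have "[i + ?t = m] (mod n)"
    by (simp only: cong_def mod_add_right_eq mod_mult_self2)
  then have "e = edge (i + ?t)" using m edge_cong by simp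
  moreover have "?t < n" using n_ge_3 by simp
  ultimately show thesis using that by blast
qed

text \<open>An edge of \<open>M\<close> shares a vertex with a chain edge; both lie in the matching
  \<open>M\<close>, so they coincide.\<close>

lemma chain_if_closed:
  assumes "matching E M" "chain i k \<subseteq> M" "\<Union>M \<subseteq> \<Union>(chain i k)"
  shows "M = chain i k"
proof
  show "M \<subseteq> chain i k"
  proof
    fix e assume e: "e \<in> M"
    then have "e \<in> E" using assms(1) by (auto simp: matching_def)
    then obtain v where "v \<in> e" by (auto simp: E_eq)
    then have "v \<in> \<Union>(chain i k)" using e assms(3) by blast
    then obtain f where f: "f \<in> chain i k" "v \<in> f" by blast
    have "e = f"
      using assms(1,2) e f \<open>v \<in> e\<close> unfolding matching_def by blast
    then show "e \<in> chain i k" using f by simp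
  qed
qed (rule assms(2))

text \<open>A connected matching that misses a vertex is a chain starting right after such a vertex;
  one that misses no vertex may start anywhere.\<close>

lemma connected_matching_is_chain:
  assumes cm: "connected_matching E M"
  shows "\<exists>i k. i < n \<and> 2 * k \<le> n \<and> M = chain i k"
proof (cases "M = {}")
  case True
  then show ?thesis using n_ge_3 by (intro exI[of _ 0]) (auto simp: chain_def)
next
  case False
  have mat: "matching E M" and con: "connected_graph (\<Union>M) (induced_edges E (\<Union>M))"
    using cm by (auto simp: connected_matching_def)
  have ME: "M \<subseteq> E" using mat by (auto simp: matching_def)
  have disj: "e = f" if "e \<in> M" "f \<in> M" "v \<in> e" "v \<in> f" for e f v
    using mat that unfolding matching_def by blast
  let ?S = "\<Union>M"
  have "\<exists>i. edge (Suc i) \<in> M \<and> (x i \<in> ?S \<longrightarrow> range x \<subseteq> ?S)"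
  proof (cases "range x \<subseteq> ?S")
    case True
    obtain e where "e \<in> M" using False by blast
    moreover then obtain t where "e = edge (1 + t)"
      using ME shifted_edge[of e 1] by blast
    ultimately show ?thesis using True by auto
  next
    case False
    then obtain r where r: "x r \<notin> ?S" by blast
    obtain e where "e \<in> M" using \<open>M \<noteq> {}\<close> by blast
    moreover then obtain t where "e = edge (r + t)"
      using ME shifted_edge[of e r] by blast
    ultimately have "x (r + t) \<in> ?S" by (auto simp: edge_def)
    \<comment> \<open>This is the first covered vertex after the uncovered \<open>x r\<close>. Its
      predecessor is uncovered, so its matching edge goes forward.\<close>
    then obtain s where s: "x (r + s) \<in> ?S" "\<And>s'. s' < s \<Longrightarrow> x (r + s') \<notin> ?S"
      using exists_least_iff[of "\<lambda>s. x (r + s) \<in> ?S"] by blast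
    then obtain p where p: "s = Suc p" using r by (cases s) auto
    let ?i = "r + p"
    have i: "x ?i \<notin> ?S" "x (Suc ?i) \<in> ?S" using s p by auto
    then obtain f where f: "f \<in> M" "x (Suc ?i) \<in> f" by blast
    then have "f = edge ?i \<or> f = edge (Suc ?i)" using incident_edge ME by blast
    then have "f = edge (Suc ?i)" using i(1) f(1) by (auto simp: edge_def)
    then show ?thesis using f i by blast
  qed
  then obtain i0 where i0: "edge (Suc i0) \<in> M" "x i0 \<in> ?S \<longrightarrow> range x \<subseteq> ?S" by blast
  define i where "i = Suc i0"
  \<comment> \<open>From \<open>i\<close> the chain is prolonged while its edges stay in
    \<open>M\<close>; \<open>2 * k \<le> n\<close> stops it from wrapping onto itself.\<close>
  define P where "P = (\<lambda>k. 2 * k \<le> n \<and> chain i k \<subseteq> M)"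
  define k where "k = (GREATEST k. P k)"
  have P1: "P 1" using i0 n_ge_3 by (auto simp: P_def chain_def i_def)
  have bnd: "y \<le> n" if "P y" for y using that by (auto simp: P_def)
  have Pk: "P k" unfolding k_def using P1 bnd by (rule GreatestI_nat[of P])
  have k1: "1 \<le> k" unfolding k_def using P1 bnd by (rule Greatest_le_nat[of P])
  have nP: "\<not> P (Suc k)"
  proof
    assume "P (Suc k)"
    then have "Suc k \<le> k" unfolding k_def using bnd by (rule Greatest_le_nat[of P])
    then show False by simp
  qed
  have last: "edge (i + 2 * (k - 1)) \<in> M" using Pk k1 by (auto simp: P_def chain_def)
  have "\<Union>M \<subseteq> \<Union>(chain i k)"
  proof (cases "2 * k + 2 \<le> n")
    case True
    have "chain i (Suc k) = insert (edge (i + 2 * k)) (chain i k)"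
      by (auto simp: chain_def lessThan_Suc)
    then have nin: "edge (i + 2 * k) \<notin> M" using nP True Pk by (auto simp: P_def)
    have last': "edge (i + 2 * k - 2) \<in> M" using last k1 by (simp add: diff_mult_distrib2)
    \<comment> \<open>A matching edge here would be the next chain edge, excluded by maximality of
      \<open>k\<close>, or the edge back to the last chain vertex, which meets the last chain
      edge.\<close>
    have end_out: "x (i + 2 * k) \<notin> ?S"
    proof
      assume "x (i + 2 * k) \<in> ?S"
      then obtain f where f: "f \<in> M" "x (i + 2 * k) \<in> f" by blast
      have sk: "i + 2 * k = Suc (Suc (i + 2 * k - 2))" "i + 2 * k - 1 = Suc (i + 2 * k - 2)"
        using k1 by auto
      have "f = edge (i + 2 * k - 1) \<or> f = edge (i + 2 * k)"
        using f ME incident_edge[of f "i + 2 * k - 1"] sk by auto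
      then have f': "f = edge (i + 2 * k - 1)" using nin f by blast
      then have "f = edge (i + 2 * k - 2)"
        using disj[of f "edge (i + 2 * k - 2)" "x (i + 2 * k - 1)"] f last' sk
        by (auto simp: edge_def)
      then show False using f' edge_neq_Suc[of "i + 2 * k - 2"] sk by simp
    qed
    then have start_out: "x i0 \<notin> ?S" using i0 by blast
    let ?T = "\<Union>(chain i k)"
    \<comment> \<open>An edge leaving the arc leads to one of its two outer neighbours, both
      uncovered. Connectivity then confines \<open>M\<close> to the arc.\<close>
    have closed: "z \<in> ?T" if "y \<in> ?T" "{y, z} \<in> induced_edges E ?S" for y z
    proof -
      obtain t where t: "t < 2 * k" "y = x (i + t)"
        using \<open>y \<in> ?T\<close> by (auto simp: Union_chain)
      have yz: "{y, z} \<in> E" "z \<in> ?S" using that by (auto simp: induced_edges_def)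
      have "{y, z} = edge (i0 + t) \<or> {y, z} = edge (Suc (i0 + t))"
        using incident_edge[of "{y, z}" "i0 + t"] yz t by (auto simp: i_def)
      moreover have "x (Suc (i0 + t)) \<noteq> x (i0 + t)" "x (Suc (i0 + t)) \<noteq> x (Suc (Suc (i0 + t)))"
        using x_add_cancel[of 0 1 "i0 + t"] x_add_cancel[of 0 1 "Suc (i0 + t)"] n_ge_3 by auto
      ultimately have "z = x (i0 + t) \<or> z = x (i + Suc t)"
        using t by (auto simp: edge_def doubleton_eq_iff i_def)
      then show ?thesis
      proof
        assume z: "z = x (i0 + t)"
        then obtain t' where "t = Suc t'" using yz start_out by (cases t) auto
        then show ?thesis using z t by (auto simp: Union_chain i_def)
      next
        assume z: "z = x (i + Suc t)"
        then have "Suc t \<noteq> 2 * k" using yz(2) end_out by metis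
        then have "Suc t < 2 * k" using t by simp
        then show ?thesis unfolding z Union_chain by blast
      qed
    qed
    have "x i \<in> ?T" using k1 by (auto simp: Union_chain image_iff intro!: bexI[of _ 0])
    have "x i \<in> ?S" using i0 by (auto simp: i_def edge_def)
    show ?thesis
    proof
      fix v assume "v \<in> ?S"
      then have "(x i, v) \<in> {(y, z). {y, z} \<in> induced_edges E ?S}\<^sup>*"
        using con \<open>x i \<in> ?S\<close> by (auto simp: connected_graph_def)
      then show "v \<in> ?T"
        using \<open>x i \<in> ?T\<close> by (induction rule: rtrancl_induct) (use closed in auto)
    qed
  next
    case False
    \<comment> \<open>Now \<open>2 * k \<ge> n - 1\<close>, so the arc misses at most one vertex and
      every edge meets it.\<close>
    have "M \<subseteq> chain i k"
    proof
      fix e assume e: "e \<in> M"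
      then obtain t where t: "t < n" "e = edge (i + t)" using ME shifted_edge[of e i] by blast
      have "\<exists>v\<in>e. v \<in> \<Union>(chain i k)"
      proof (cases "t < 2 * k")
        case True
        then show ?thesis using t by (auto simp: edge_def Union_chain)
      next
        case ge: False
        \<comment> \<open>The only offset beyond the arc is \<open>n - 1\<close>; its edge closes
          the cycle at \<open>x i\<close>.\<close>
        then have "Suc t = n" using t False Pk by (auto simp: P_def)
        then have "x (i + Suc t) = x (i + 0)" using x_period[of i] by simp
        moreover have "x (i + 0) \<in> (\<lambda>t. x (i + t)) ` {..<2 * k}" using k1 by (intro imageI) simp
        ultimately show ?thesis unfolding t(2) edge_def Union_chain by auto
      qed
      then obtain v f where "v \<in> e" "v \<in> f" "f \<in> chain i k" by blast
      moreover have "chain i k \<subseteq> M" using Pk by (simp add: P_def)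
      ultimately show "e \<in> chain i k" using disj[of e f v] e by auto
    qed
    then show ?thesis by blast
  qed
  then have "M = chain i k"
    using chain_if_closed[of M i k] mat Pk by (auto simp: P_def)
  moreover have "edge (i + 2 * j) = edge (i mod n + 2 * j)" for j
    by (rule edge_cong) (simp add: cong_def mod_add_left_eq)
  then have "chain i k = chain (i mod n) k" unfolding chain_def by (intro image_cong refl)
  ultimately have "M = chain (i mod n) k" by (rule trans)
  moreover have "i mod n < n" "2 * k \<le> n" using Pk n_ge_3 by (simp_all add: P_def)
  ultimately show ?thesis by blast
qed

end

section \<open>Walking around a cycle from a given edge\<close>

text \<open>The program starts with the first listed edge in its listed orientation, so a walk must
  exist from every edge in either direction.\<close>

lemma cyclic_walk_exists:
  assumes "cycle_graph V E" "{u, v} \<in> E"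
  shows "\<exists>x. cyclic_walk (card V) x E \<and> range x = V \<and> x 0 = u \<and> x 1 = v"
proof -
  obtain vs where vs: "length vs \<ge> 3" "distinct vs" "V = set vs"
    "E = {{vs ! i, vs ! (Suc i mod length vs)} | i. i < length vs}"
    using assms(1) by (auto simp: cycle_graph_def)
  let ?n = "length vs"
  have card: "card V = ?n" using vs distinct_card by blast
  have nz: "?n > 0" using vs by auto
  obtain i where i: "i < ?n" "{u, v} = {vs ! i, vs ! (Suc i mod ?n)}"
    using assms(2) unfolding vs(4) by blast
  \<comment> \<open>The step \<open>d\<close> runs forward through \<open>vs\<close> if it is 1, and
    backward if it is \<open>?n - 1\<close>, that is \<open>- 1\<close> modulo
    \<open>?n\<close>.\<close>
  have *: "\<exists>x. cyclic_walk ?n x E \<and> range x = V \<and> x 0 = vs ! (r mod ?n) \<and> x 1 = vs ! ((r + d) mod ?n)"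
    if d: "d = 1 \<or> d = ?n - 1" for r d
  proof -
    define x where "x k = vs ! ((r + d * k) mod ?n)" for k
    have cop: "coprime d ?n" using d nz coprime_diff_one_left_nat by auto
    have eq: "x i = x j \<longleftrightarrow> [i = j] (mod ?n)" for i j
    proof -
      have "x i = x j \<longleftrightarrow> [r + d * i = r + d * j] (mod ?n)"
        using vs nz by (simp add: x_def nth_eq_iff_index_eq cong_def)
      then show ?thesis
        using cop by (simp add: cong_add_lcancel_nat cong_mult_lcancel_nat)
    qed
    have surj: "\<exists>k. p = (r + d * k) mod ?n" if p: "p < ?n" for p
    proof -
      \<comment> \<open>\<open>b\<close> inverts \<open>d\<close> and \<open>c\<close> represents
        \<open>p - r\<close> modulo \<open>?n\<close>, so \<open>b * c\<close> is the index
        sought.\<close>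
      obtain b where b: "[d * b = 1] (mod ?n)" using cong_solve_coprime_nat[OF cop] by auto
      define c where "c = p + (?n - 1) * r"
      have "[r + d * (b * c) = r + 1 * c] (mod ?n)"
        unfolding mult.assoc[symmetric] using b by (intro cong_add cong_mult) auto
      also have "r + 1 * c = p + r * ?n"
        using nz unfolding c_def by (cases ?n) (auto simp: algebra_simps)
      finally have "(r + d * (b * c)) mod ?n = p" using p by (simp add: cong_def)
      then show ?thesis by blast
    qed
    have rng: "range x = V"
    proof
      show "range x \<subseteq> V" using nz by (auto simp: x_def vs(3))
    next
      show "V \<subseteq> range x"
      proof
        fix y assume "y \<in> V"
        then obtain p where "p < ?n" "y = vs ! p" unfolding vs(3) in_set_conv_nth by blast
        moreover then obtain k where "p = (r + d * k) mod ?n" using surj by blast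
        ultimately have "y = x k" by (simp add: x_def)
        then show "y \<in> range x" by blast
      qed
    qed
    have edges: "{x k, x (Suc k)} \<in> E" for k
      using d
    proof
      assume d: "d = 1"
      let ?p = "(r + k) mod ?n"
      have "{x k, x (Suc k)} = {vs ! ?p, vs ! (Suc ?p mod ?n)}"
        by (simp add: x_def d mod_Suc_eq)
      moreover have "?p < ?n" using nz by simp
      ultimately show ?thesis unfolding vs(4) by blast
    next
      assume d: "d = ?n - 1"
      let ?p = "(r + d * Suc k) mod ?n"
      have "Suc d = ?n" using d nz by simp
      then have "Suc (r + d * Suc k) = r + d * k + ?n" by (simp flip: \<open>Suc d = ?n\<close>)
      then have "Suc ?p mod ?n = (r + d * k) mod ?n"
        by (simp only: mod_Suc_eq mod_add_self2)
      then have "{x k, x (Suc k)} = {vs ! ?p, vs ! (Suc ?p mod ?n)}" by (auto simp: x_def)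
      moreover have "?p < ?n" using nz by simp
      ultimately show ?thesis unfolding vs(4) by blast
    qed
    \<comment> \<open>Counting turns inclusion into equality: the walk has \<open>?n\<close>
      distinct edges, all in \<open>E\<close>, and \<open>E\<close> has at most
      \<open>?n\<close>.\<close>
    interpret W: cyclic_walk ?n x "range (\<lambda>i. {x i, x (Suc i)})"
      by unfold_locales (rule vs(1), rule eq, rule refl)
    have "E = (\<lambda>i. {vs ! i, vs ! (Suc i mod ?n)}) ` {..<?n}" unfolding vs(4) by blast
    then have "finite E" "card E \<le> ?n"
      using card_image_le[of "{..<?n}" "\<lambda>i. {vs ! i, vs ! (Suc i mod ?n)}"] by simp_all
    have "inj_on (\<lambda>i. {x i, x (Suc i)}) {..<?n}"
      by (rule inj_onI) (use W.edge_eq_iff in \<open>simp add: W.edge_def cong_def\<close>)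
    then have "card ((\<lambda>i. {x i, x (Suc i)}) ` {..<?n}) = ?n"
      using card_image by fastforce
    moreover have "(\<lambda>i. {x i, x (Suc i)}) ` {..<?n} \<subseteq> E" using edges by blast
    ultimately have "(\<lambda>i. {x i, x (Suc i)}) ` {..<?n} = E"
      using \<open>finite E\<close> \<open>card E \<le> ?n\<close> by (intro card_seteq) simp_all
    then have "E \<subseteq> range (\<lambda>i. {x i, x (Suc i)})" by (rule equalityD2[THEN subset_trans]) auto
    then have "E = range (\<lambda>i. {x i, x (Suc i)})" using edges by (intro equalityI) auto
    then have "cyclic_walk ?n x E" using W.cyclic_walk_axioms by (rule ssubst)
    moreover have "x 0 = vs ! (r mod ?n)" "x 1 = vs ! ((r + d) mod ?n)" by (simp_all add: x_def)
    ultimately show ?thesis using rng by blast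
  qed
  show ?thesis
  proof (cases "u = vs ! i")
    case True
    then have "v = vs ! ((i + 1) mod ?n)" using i(2) by (simp add: doubleton_eq_iff) metis
    then show ?thesis using *[of 1 i] True i(1) card by simp
  next
    case False
    then have uv: "u = vs ! (Suc i mod ?n)" "v = vs ! i" using i(2) by (auto simp: doubleton_eq_iff)
    have "Suc i + (?n - 1) = i + ?n" using nz by simp
    then have "(Suc i + (?n - 1)) mod ?n = i" using i(1) by simp
    then show ?thesis using *[of "?n - 1" "Suc i"] uv card by simp
  qed
qed

section \<open>Weakest preconditions with running time\<close>

text \<open>Time is an argument of the postcondition, so correctness and running time are proved
  together. Asking for a run includes termination and the word bound.\<close>

definition wp :: "nat \<Rightarrow> com \<Rightarrow> state \<Rightarrow> (nat \<Rightarrow> state \<Rightarrow> bool) \<Rightarrow> bool" where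
  "wp L c s Q \<longleftrightarrow> (\<exists>t s'. exec L c s t s' \<and> Q t s')"

lemma wp_simps:
  "wp L Skip s Q \<longleftrightarrow> Q 1 s"
  "wp L (IAssign x e) s Q \<longleftrightarrow>
     ifits L s e \<and> Q (1 + icost e) (s\<lparr>ivar := (ivar s)(x := ival s e)\<rparr>)"
  "wp L (IStore a i e) s Q \<longleftrightarrow>
     ifits L s i \<and> ifits L s e \<and> Q (1 + icost i + icost e)
       (s\<lparr>iarr := (iarr s)(a := (iarr s a)(ival s i := ival s e))\<rparr>)"
  "wp L (RAssign x r) s Q \<longleftrightarrow>
     rfits L s r \<and> Q (1 + rcost r) (s\<lparr>rvar := (rvar s)(x := rval s r)\<rparr>)"
  "wp L (RStore a i r) s Q \<longleftrightarrow>
     ifits L s i \<and> rfits L s r \<and> Q (1 + icost i + rcost r)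
       (s\<lparr>rarr := (rarr s)(a := (rarr s a)(ival s i := rval s r))\<rparr>)"
  "wp L (Seq c d) s Q \<longleftrightarrow> wp L c s (\<lambda>t s'. wp L d s' (\<lambda>t'. Q (t + t')))"
  unfolding wp_def
  by (fastforce intro: exec.intros elim: exec_SkipE exec_IAssignE exec_IStoreE exec_RAssignE
      exec_RStoreE exec_SeqE)+

lemma wp_Cond:
  "wp L (Cond b c d) s Q \<longleftrightarrow>
     bfits L s b \<and> wp L (if bval s b then c else d) s (\<lambda>t. Q (1 + bcost b + t))"
proof
  assume "wp L (Cond b c d) s Q"
  then obtain t s' where "exec L (Cond b c d) s t s'" "Q t s'" by (auto simp: wp_def)
  then show "bfits L s b \<and> wp L (if bval s b then c else d) s (\<lambda>t. Q (1 + bcost b + t))"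
    by (cases rule: exec_CondE[consumes 1]) (auto simp: wp_def)
next
  assume a: "bfits L s b \<and> wp L (if bval s b then c else d) s (\<lambda>t. Q (1 + bcost b + t))"
  then obtain t s' where "exec L (if bval s b then c else d) s t s'" "Q (1 + bcost b + t) s'"
    by (auto simp: wp_def)
  moreover from this(1) a have "exec L (Cond b c d) s (1 + bcost b + t) s'"
    using exec_CondTrue[of L s b c t s' d] exec_CondFalse[of L s b d t s' c] by (cases "bval s b") auto
  ultimately show "wp L (Cond b c d) s Q" unfolding wp_def by blast
qed

definition for_loop :: "nat \<Rightarrow> iexp \<Rightarrow> com \<Rightarrow> com" where
  "for_loop x e c = Seq (IAssign x (IConst 0))
     (While (ILess (IVar x) e) (Seq c (IAssign x (IAdd (IVar x) (IConst 1)))))"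

text \<open>\<open>I k\<close> describes the state before iteration \<open>k\<close>, with the
  counter already at \<open>k\<close>. The bound \<open>e\<close> is evaluated anew at each test, so
  the invariant must fix its value.\<close>

lemma wp_for_loop:
  assumes init: "I 0 (s\<lparr>ivar := (ivar s)(x := 0)\<rparr>)"
    and inv: "\<And>k s. k \<le> N \<Longrightarrow> I k s \<Longrightarrow> ivar s x = k \<and> ifits L s e \<and> ival s e = N"
    and body: "\<And>k s. k < N \<Longrightarrow> I k s \<Longrightarrow>
      wp L c s (\<lambda>t s'. t \<le> B \<and> ivar s' x = k \<and> I (Suc k) (s'\<lparr>ivar := (ivar s')(x := Suc k)\<rparr>))"
    and N: "N < L"
    and post: "\<And>t s'. t \<le> (N + 1) * (B + icost e + 8) \<Longrightarrow> I N s' \<Longrightarrow> Q t s'"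
  shows "wp L (for_loop x e c) s Q"
proof -
  let ?body = "Seq c (IAssign x (IAdd (IVar x) (IConst 1)))"
  let ?W = "While (ILess (IVar x) e) ?body"
  \<comment> \<open>Induction on the remaining iterations: each adds \<open>icost e + 3\<close> for
    the test and 4 for the increment to the cost of the body, and the failing test ends the
    loop.\<close>
  have loop: "\<exists>t s'. exec L ?W s t s' \<and> I N s' \<and> t \<le> (N - k) * (B + icost e + 7) + icost e + 3"
    if "k \<le> N" "I k s" for k s
    using that
  proof (induction "N - k" arbitrary: k s)
    case 0
    then have "k = N" by simp
    then show ?case using 0 inv[of k s] exec_WhileFalse[of L s "ILess (IVar x) e" ?body]
      N by (intro exI[of _ "1 + bcost (ILess (IVar x) e)"] exI[of _ s]) auto
  next
    case (Suc d)
    then have k: "k < N" by simp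
    have fit: "bfits L s (ILess (IVar x) e)" "bval s (ILess (IVar x) e)"
      using inv[of k s] Suc.prems k N by auto
    obtain t1 s1 where 1: "exec L c s t1 s1" "t1 \<le> B" "ivar s1 x = k"
      "I (Suc k) (s1\<lparr>ivar := (ivar s1)(x := Suc k)\<rparr>)"
      using body[OF k Suc.prems(2)] by (auto simp: wp_def)
    let ?s2 = "s1\<lparr>ivar := (ivar s1)(x := Suc k)\<rparr>"
    have "exec L (IAssign x (IAdd (IVar x) (IConst 1))) s1 4 ?s2"
      using exec_IAssign[of L s1 "IAdd (IVar x) (IConst 1)" x] 1(3) k N
      by (simp add: numeral_eq_Suc)
    then have 2: "exec L ?body s (t1 + 4) ?s2" using 1(1) exec_Seq by blast
    have d: "d = N - Suc k" using Suc.hyps(2) by simp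
    obtain t3 s3 where 3: "exec L ?W ?s2 t3 s3" "I N s3"
      "t3 \<le> (N - Suc k) * (B + icost e + 7) + icost e + 3"
      using Suc.hyps(1)[OF d _ 1(4)] k by auto
    have "exec L ?W s (1 + bcost (ILess (IVar x) e) + (t1 + 4) + t3) s3"
      using exec_WhileTrue[OF fit 2 3(1)] .
    moreover have "N - k = Suc (N - Suc k)" using k by simp
    then have "1 + bcost (ILess (IVar x) e) + (t1 + 4) + t3 \<le> (N - k) * (B + icost e + 7) + icost e + 3"
      using 1(2) 3(3) by simp
    ultimately show ?case using 3(2) by blast
  qed
  obtain t s' where W: "exec L ?W (s\<lparr>ivar := (ivar s)(x := 0)\<rparr>) t s'" "I N s'"
    "t \<le> N * (B + icost e + 7) + icost e + 3"
    using loop[of 0, OF _ init] by auto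
  have "exec L (IAssign x (IConst 0)) s 2 (s\<lparr>ivar := (ivar s)(x := 0)\<rparr>)"
    using exec_IAssign[of L s "IConst 0" x] by (simp add: numeral_eq_Suc)
  then have "exec L (for_loop x e c) s (2 + t) s'"
    unfolding for_loop_def using W(1) exec_Seq by blast
  moreover have "2 + t \<le> (N + 1) * (B + icost e + 8)"
    using W(3) by (simp add: algebra_simps)
  ultimately show ?thesis using post W(2) unfolding wp_def by blast
qed

section \<open>The program\<close>

text \<open>Word array 3 holds, for each vertex, the sum of the positions of its two incident edges. While
  walking along the cycle, the next edge is this sum minus the current edge, and the next vertex
  is the sum of the endpoints minus the current vertex. Two rounds are walked, so that no index
  has to be reduced modulo \<open>n\<close>. Word array 4 is the sequence of edges met, real array 1 the prefix
  weights, word array 5 the argmins within the parity class, and the word variables 6 and 7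
  are the ends of the best chain so far.\<close>

definition incidence_loop :: com where
  "incidence_loop = for_loop 2 (IVar 1)
     (Seq (IStore 3 (IArr 0 (IVar 2)) (IAdd (IArr 3 (IArr 0 (IVar 2))) (IVar 2)))
          (IStore 3 (IArr 1 (IVar 2)) (IAdd (IArr 3 (IArr 1 (IVar 2))) (IVar 2))))"

definition walk_loop :: com where
  "walk_loop = for_loop 2 (IAdd (IVar 0) (IVar 0))
     (Seq (IStore 4 (IVar 2) (IVar 3))
     (Seq (RStore 1 (IAdd (IVar 2) (IConst 2)) (RAdd (RArr 1 (IVar 2)) (RArr 0 (IVar 3))))
     (Seq (IAssign 3 (ISub (IArr 3 (IVar 4)) (IVar 3)))
          (IAssign 4 (ISub (IAdd (IArr 0 (IVar 3)) (IArr 1 (IVar 3))) (IVar 4))))))"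

text \<open>\<open>g\<close> yields the new start candidate and \<open>h\<close> the end examined,
  so one loop serves both scanning directions.\<close>

definition scan_loop :: "iexp \<Rightarrow> iexp \<Rightarrow> com" where
  "scan_loop g h = for_loop 2 (IAdd (IVar 5) (IConst 1))
     (Seq (Cond (BAnd (ILess (IConst 1) (IVar 2))
                      (BNot (RLess (RArr 1 g) (RArr 1 (IArr 5 (ISub (IVar 2) (IConst 2)))))))
             (IStore 5 (IVar 2) (IArr 5 (ISub (IVar 2) (IConst 2))))
             (IStore 5 (IVar 2) g))
          (Cond (RLess (RSub (RArr 1 (IVar 7)) (RArr 1 (IVar 6)))
                       (RSub (RArr 1 h) (RArr 1 (IArr 5 (IVar 2)))))
             (Seq (IAssign 6 (IArr 5 (IVar 2))) (IAssign 7 h))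
             Skip))"

definition mark_loop :: com where
  "mark_loop = for_loop 2 (IDiv (ISub (IVar 7) (IVar 6)) (IConst 2))
     (IStore 2 (IArr 4 (IAdd (IVar 6) (IAdd (IVar 2) (IVar 2)))) (IConst 1))"

text \<open>The walk starts at input edge 0 (word 3 is still zero), heading for its second endpoint.
  Word 5 holds \<open>H\<close>. The second scan uses starts \<open>H - k\<close> and ends
  \<open>2 * H - k\<close>, so its candidates form a suffix of the starts.\<close>

definition cycle_program :: com where
  "cycle_program =
     Seq incidence_loop
     (Seq (IAssign 4 (IArr 1 (IConst 0)))
     (Seq walk_loop
     (Seq (IAssign 5 (IMul (IConst 2) (IDiv (IVar 0) (IConst 2))))
     (Seq (scan_loop (IVar 2) (IVar 2))
     (Seq (scan_loop (ISub (IVar 5) (IVar 2)) (ISub (IAdd (IVar 5) (IVar 5)) (IVar 2)))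
          mark_loop)))))"

section \<open>Scanning for argmins within parity classes\<close>

text \<open>A step by two adds one index to the parity class, which yields the update of array 5.
  The bounds on \<open>z\<close> are explicit because a truncated difference is even too.\<close>

lemma parity_step:
  "z \<le> Suc (Suc m) \<and> even (Suc (Suc m) - z) \<longleftrightarrow> z = Suc (Suc m) \<or> z \<le> m \<and> even (m - z)"
  by (cases "z \<le> m") (auto simp: Suc_diff_le le_Suc_eq)

text \<open>The \<open>k\<close>-th iteration adds \<open>G k\<close> to the candidates for the start and evaluates the end
  \<open>K k\<close>; the candidates for the latter are those \<open>G z\<close> with \<open>z \<le> k\<close> of the same parity.\<close>

lemma wp_scan_loop:
  fixes q :: "nat \<Rightarrow> real" and G K :: "nat \<Rightarrow> nat" and C :: "(nat \<times> nat) set"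
  assumes expr: "\<And>k s. k \<le> H \<Longrightarrow> ivar s 2 = k \<Longrightarrow> ivar s 5 = H \<Longrightarrow>
      ifits L s g \<and> ival s g = G k \<and> ifits L s h \<and> ival s h = K k"
    and cost: "icost g \<le> 5" "icost h \<le> 5"
    and L: "2 * H + 2 \<le> L"
    and GK: "\<And>y z. z \<le> y \<Longrightarrow> y \<le> H \<Longrightarrow> even (y - z) \<Longrightarrow> (G z, K y) \<in> C"
    and C: "C \<subseteq> {(i, j). i \<le> L \<and> j \<le> L}"
    and init: "ivar s 5 = H" "\<And>y. iarr s 5 y \<le> L" "rarr s 1 = q" "(ivar s 6, ivar s 7) \<in> C"
    and post: "\<And>t s'. t \<le> (H + 2) * 100 \<Longrightarrow> ivar s' 5 = H \<Longrightarrow> iarr s' 2 = iarr s 2 \<Longrightarrow>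
      iarr s' 4 = iarr s 4 \<Longrightarrow> (\<And>y. iarr s' 5 y \<le> L) \<Longrightarrow> rarr s' 1 = q \<Longrightarrow>
      (ivar s' 6, ivar s' 7) \<in> C \<Longrightarrow>
      q (ivar s 7) - q (ivar s 6) \<le> q (ivar s' 7) - q (ivar s' 6) \<Longrightarrow>
      (\<And>y z. z \<le> y \<Longrightarrow> y \<le> H \<Longrightarrow> even (y - z) \<Longrightarrow>
        q (K y) - q (G z) \<le> q (ivar s' 7) - q (ivar s' 6)) \<Longrightarrow> Q t s'"
  shows "wp L (scan_loop g h) s Q"
proof -
  \<comment> \<open>\<open>A y a\<close>: \<open>a\<close> is a best start for the end
    \<open>K y\<close> among its candidates. \<open>D\<close> is the value of the stored
    pair.\<close>
  define A where "A y a \<longleftrightarrow> (\<exists>z\<le>y. even (y - z) \<and> a = G z) \<and>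
      (\<forall>z\<le>y. even (y - z) \<longrightarrow> q a \<le> q (G z))" for y a
  define D where "D s' = q (ivar s' 7) - q (ivar s' 6)" for s' :: state
  \<comment> \<open>All of array 5 must stay within \<open>L\<close>, since the guard reads it even
    for \<open>k < 2\<close>, where the truncated index is 0.\<close>
  define I where "I k s' \<longleftrightarrow> ivar s' 2 = k \<and> ivar s' 5 = H \<and> iarr s' 2 = iarr s 2 \<and>
      iarr s' 4 = iarr s 4 \<and> (\<forall>y. iarr s' 5 y \<le> L) \<and> rarr s' 1 = q \<and>
      (ivar s' 6, ivar s' 7) \<in> C \<and> D s \<le> D s' \<and>
      (\<forall>y<k. A y (iarr s' 5 y)) \<and>
      (\<forall>y z. z \<le> y \<longrightarrow> y < k \<longrightarrow> even (y - z) \<longrightarrow> q (K y) - q (G z) \<le> D s')" for k s'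
  have G_le: "G k \<le> L" if "k \<le> H" for k using GK[of k k] C that by auto
  have A_C: "(a, K k) \<in> C" if "A k a" "k \<le> H" for k a
    using that GK unfolding A_def by blast
  have A_min: "q (K k) - q (G z) \<le> q (K k) - q a" if "A k a" "z \<le> k" "even (k - z)" for k a z
    using that unfolding A_def by simp
  \<comment> \<open>The first conditional either keeps the minimiser of two iterations earlier
    (\<open>A_keep\<close>) or installs the new candidate (\<open>A_new\<close>).\<close>
  have A_keep: "A k a" if a: "A (k - 2) a" "1 < k" "q a \<le> q (G k)" for k a
  proof -
    obtain m where m: "k = Suc (Suc m)" using \<open>1 < k\<close> by (auto simp: less_iff_Suc_add)
    have am: "A m a" using a(1) m by simp
    then obtain z0 where "z0 \<le> m" "even (m - z0)" "a = G z0" unfolding A_def by blast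
    then have "z0 \<le> k" "even (k - z0)" "a = G z0" using parity_step[of z0 m] m by simp_all
    moreover have "q a \<le> q (G z)" if z: "z \<le> k" "even (k - z)" for z
    proof (cases "z = k")
      case False
      then have "z \<le> m" "even (m - z)" using z parity_step[of z m] m by simp_all
      then show ?thesis using am unfolding A_def by blast
    qed (use a(3) in simp)
    ultimately show ?thesis unfolding A_def by blast
  qed
  have A_new: "A k (G k)" if a: "1 < k \<longrightarrow> (\<exists>a. A (k - 2) a \<and> q (G k) \<le> q a)" for k
  proof -
    have "q (G k) \<le> q (G z)" if z: "z \<le> k" "even (k - z)" for z
    proof (cases "z = k")
      case False
      then have "1 < k" using z by (cases k; cases "k - 1") (auto simp: le_Suc_eq)
      then obtain m where m: "k = Suc (Suc m)" by (auto simp: less_iff_Suc_add)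
      then obtain b where b: "A m b" "q (G k) \<le> q b" using a \<open>1 < k\<close> by auto
      have "z \<le> m" "even (m - z)" using z False parity_step[of z m] m by simp_all
      then have "q b \<le> q (G z)" using b(1) unfolding A_def by blast
      then show ?thesis using b(2) by simp
    qed simp
    then show ?thesis unfolding A_def by (auto intro!: exI[of _ k])
  qed
  have body: "wp L (Seq (Cond (BAnd (ILess (IConst 1) (IVar 2))
                      (BNot (RLess (RArr 1 g) (RArr 1 (IArr 5 (ISub (IVar 2) (IConst 2)))))))
             (IStore 5 (IVar 2) (IArr 5 (ISub (IVar 2) (IConst 2))))
             (IStore 5 (IVar 2) g))
          (Cond (RLess (RSub (RArr 1 (IVar 7)) (RArr 1 (IVar 6)))
                       (RSub (RArr 1 h) (RArr 1 (IArr 5 (IVar 2)))))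
             (Seq (IAssign 6 (IArr 5 (IVar 2))) (IAssign 7 h))
             Skip)) s'
       (\<lambda>t s''. t \<le> 80 \<and> ivar s'' 2 = k \<and> I (Suc k) (s''\<lparr>ivar := (ivar s'')(2 := Suc k)\<rparr>))"
    if k: "k < H + 1" and I: "I k s'" for k s'
  proof -
    have kH: "k \<le> H" using k by simp
    have s': "ivar s' 2 = k" "ivar s' 5 = H" "rarr s' 1 = q" "(ivar s' 6, ivar s' 7) \<in> C"
      "\<And>y. iarr s' 5 y \<le> L" "\<And>y. y < k \<Longrightarrow> A y (iarr s' 5 y)"
      using I by (auto simp: I_def)
    note ex = expr[OF kH]
    have L': "ivar s' 6 \<le> L" "ivar s' 7 \<le> L" "k \<le> L" "1 \<le> L" "2 \<le> L" using s'(4) C L kH by auto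
    have old: "q (K y) - q (G z) \<le> D s'" if "z \<le> y" "y < k" "even (y - z)" for y z
      using I that unfolding I_def by blast
    \<comment> \<open>Common to all branches: \<open>a\<close> is the stored minimiser, and the best
      pair is kept or replaced by \<open>(a, K k)\<close>, whichever is no worse.\<close>
    have step: "I (Suc k) r"
      if a: "A k a" "a \<le> L"
        and r: "iarr r 5 = (iarr s' 5)(k := a)" "iarr r 2 = iarr s' 2" "iarr r 4 = iarr s' 4"
          "rarr r 1 = q" "ivar r 5 = H" "ivar r 2 = Suc k"
        and b: "ivar r 6 = ivar s' 6 \<and> ivar r 7 = ivar s' 7 \<and> q (K k) - q a \<le> D s' \<or>
          ivar r 6 = a \<and> ivar r 7 = K k \<and> D s' \<le> q (K k) - q a" for r a
    proof -
      have D: "D s' \<le> D r" "q (K k) - q a \<le> D r" "(ivar r 6, ivar r 7) \<in> C"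
        using b s'(4) A_C[OF a(1) kH] unfolding D_def by auto
      have new: "q (K y) - q (G z) \<le> D r" if "z \<le> y" "y < Suc k" "even (y - z)" for y z
      proof (cases "y = k")
        case True
        then show ?thesis using A_min[OF a(1), of z] that D(2) by simp
      next
        case False
        then show ?thesis using old[of z y] that D(1) by simp
      qed
      have "A y (iarr r 5 y)" if "y < Suc k" for y
        using that a(1) s'(6)[of y] r(1) by (cases "y = k") simp_all
      moreover have "iarr r 5 y \<le> L" for y using r(1) a(2) s'(5) by simp
      moreover have "D s \<le> D r" "iarr r 2 = iarr s 2" "iarr r 4 = iarr s 4"
        using I D(1) r unfolding I_def by simp_all
      ultimately show ?thesis
        using new D(3) r(4-6) unfolding I_def by blast
    qed
    show ?thesis
    proof (cases "1 < k \<and> q (iarr s' 5 (k - 2)) \<le> q (G k)")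
      case True
      let ?a = "iarr s' 5 (k - 2)"
      have a: "A k ?a" using A_keep[of k ?a] s'(6)[of "k - 2"] True by auto
      show ?thesis
        using True s' L' ex cost L
        apply (simp add: wp_simps wp_Cond)
        apply (intro conjI impI; (rule step[OF a])?; simp add: D_def)
        done
    next
      case False
      have a: "A k (G k)"
      proof (rule A_new, intro impI)
        assume "1 < k"
        then show "\<exists>a. A (k - 2) a \<and> q (G k) \<le> q a" using False s'(6)[of "k - 2"] by auto
      qed
      show ?thesis
        using False s' L' ex cost L G_le[OF kH]
        apply (simp add: wp_simps wp_Cond)
        apply (intro conjI impI; (rule step[OF a])?; simp add: D_def)
        done
    qed
  qed
  show ?thesis
    unfolding scan_loop_def
  \<comment> \<open>\<open>k\<close> runs through \<open>0, ..., H\<close>; the loop rule charges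
    \<open>80 + 3 + 8\<close>, below the promised 100.\<close>
  proof (rule wp_for_loop[where I = I and N = "H + 1" and B = 80])
    show "I 0 (s\<lparr>ivar := (ivar s)(2 := 0)\<rparr>)"
      using init by (simp add: I_def D_def)
  next
    fix t s' assume "t \<le> (H + 1 + 1) * (80 + icost (IAdd (IVar 5) (IConst 1)) + 8)" "I (H + 1) s'"
    then show "Q t s'"
      by (intro post) (simp_all add: I_def D_def)
  qed (use L body in \<open>auto simp: I_def\<close>)
qed

section \<open>Correctness of the program\<close>

locale cycle_input = cyclic_walk n x E
  for n :: nat and x :: "nat \<Rightarrow> nat" and E :: "nat set set" +
  fixes es :: "(nat \<times> nat) list" and w :: "nat set \<Rightarrow> real" and L :: nat
  assumes range_x: "range x = {..<n}"
    and edge_list: "edge_list E es"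
    and x_0: "x 0 = fst (es ! 0)" and x_1: "x 1 = snd (es ! 0)"
    and L_ge: "4 * n + 4 \<le> L"
begin

text \<open>The default 0 makes \<open>U\<close>, \<open>V\<close> and \<open>W\<close> equal to the
  input arrays as they stand in memory.\<close>

definition U :: "nat \<Rightarrow> nat" where "U i = (if i < length es then fst (es ! i) else 0)"
definition V :: "nat \<Rightarrow> nat" where "V i = (if i < length es then snd (es ! i) else 0)"
definition W :: "nat \<Rightarrow> real" where
  "W i = (if i < length es then w {fst (es ! i), snd (es ! i)} else 0)"

definition idx :: "nat \<Rightarrow> nat" where
  "idx k = (THE j. j < n \<and> {U j, V j} = edge k)"

text \<open>Two interleaved prefix sums, one per parity class.\<close>

fun prefix_weight :: "nat \<Rightarrow> real" where
  "prefix_weight (Suc (Suc k)) = prefix_weight k + w (edge k)"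
| "prefix_weight _ = 0"

definition incidence_sum :: "nat \<Rightarrow> nat \<Rightarrow> nat" where
  "incidence_sum k v = (\<Sum>j<k. if v \<in> {U j, V j} then j else 0)"

lemma E_image: "E = edge ` {..<n}"
proof
  show "E \<subseteq> edge ` {..<n}"
  proof
    fix e assume "e \<in> E"
    then obtain t where "t < n" "e = edge (0 + t)" using shifted_edge by metis
    then show "e \<in> edge ` {..<n}" by simp
  qed
qed (use edge_in in blast)

lemma card_E: "card E = n"
  unfolding E_image by (subst card_image) (auto simp: inj_on_def edge_eq_iff cong_def)

lemma input_edges: "map (\<lambda>j. {U j, V j}) [0..<length es] = map (\<lambda>(u, v). {u, v}) es"
  by (rule nth_equalityI) (auto simp: U_def V_def split: prod.splits)

lemma length_es: "length es = n"
  using edge_list distinct_card[of "map (\<lambda>(u, v). {u, v}) es"] card_E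
  by (simp add: edge_list_def del: set_map)

lemma inj_input: "inj_on (\<lambda>j. {U j, V j}) {..<n}"
  and image_input: "(\<lambda>j. {U j, V j}) ` {..<n} = E"
proof -
  have "distinct (map (\<lambda>j. {U j, V j}) [0..<n])" "set (map (\<lambda>j. {U j, V j}) [0..<n]) = E"
    using edge_list length_es unfolding edge_list_def input_edges[symmetric] by simp_all
  then show "inj_on (\<lambda>j. {U j, V j}) {..<n}" "(\<lambda>j. {U j, V j}) ` {..<n} = E"
    by (simp_all add: distinct_map lessThan_atLeast0)
qed

lemma idx: "idx k < n" "{U (idx k), V (idx k)} = edge k"
proof -
  have "edge k \<in> (\<lambda>j. {U j, V j}) ` {..<n}" unfolding image_input by (rule edge_in)
  then obtain j where j: "j < n" "{U j, V j} = edge k" by (metis (no_types, lifting) imageE lessThan_iff)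
  have "idx k < n \<and> {U (idx k), V (idx k)} = edge k"
    unfolding idx_def
  proof (rule theI)
    show "j < n \<and> {U j, V j} = edge k" using j by simp
  next
    fix i assume "i < n \<and> {U i, V i} = edge k"
    then show "i = j" using inj_onD[OF inj_input, of i j] j by simp
  qed
  then show "idx k < n" "{U (idx k), V (idx k)} = edge k" by simp_all
qed

lemma idx_eqI: "j < n \<Longrightarrow> {U j, V j} = edge k \<Longrightarrow> idx k = j"
  using idx[of k] inj_onD[OF inj_input, of "idx k" j] by simp

text \<open>Ensures that the two stores for one edge hit different entries of word array 3.\<close>

lemma U_neq_V: "j < n \<Longrightarrow> U j \<noteq> V j"
proof -
  assume "j < n"
  then obtain k where "{U j, V j} = {x k, x (Suc k)}" using image_input E_eq by blast
  then show ?thesis using x_add_cancel[of 0 1 k] n_ge_3 by (auto simp: doubleton_eq_iff)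
qed

lemma UV_less: "j < n \<Longrightarrow> U j < n" "j < n \<Longrightarrow> V j < n"
proof -
  assume "j < n"
  then obtain k where "{U j, V j} = {x k, x (Suc k)}" using image_input E_eq by blast
  moreover have "x k < n" "x (Suc k) < n" using range_x by auto
  ultimately show "U j < n" "V j < n" by (auto simp: doubleton_eq_iff)
qed

lemma x_less: "x k < n" using range_x by auto

lemma UV_idx_sum: "U (idx k) + V (idx k) = x k + x (Suc k)"
  using idx(2)[of k] by (auto simp: edge_def doubleton_eq_iff)

lemma W_idx: "W (idx k) = w (edge k)"
  using idx[of k] length_es by (simp add: W_def U_def V_def)

lemma idx_0: "idx 0 = 0"
  using n_ge_3 length_es x_0 x_1 by (intro idx_eqI) (auto simp: U_def V_def edge_def)

text \<open>Exactly two edges meet \<open>x (Suc m)\<close>, at different positions. Subtracting the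
  current position thus yields the next one.\<close>

lemma incidence_sum_full: "incidence_sum n (x (Suc m)) = idx m + idx (Suc m)"
proof -
  have "j = idx m \<or> j = idx (Suc m) \<longleftrightarrow> x (Suc m) \<in> {U j, V j}" if j: "j < n" for j
  proof
    assume "x (Suc m) \<in> {U j, V j}"
    moreover have "{U j, V j} \<in> E" using j image_input by blast
    ultimately have "{U j, V j} = edge m \<or> {U j, V j} = edge (Suc m)" by (rule incident_edge[rotated])
    then show "j = idx m \<or> j = idx (Suc m)" using idx_eqI[OF j] by metis
  next
    assume "j = idx m \<or> j = idx (Suc m)"
    then have "{U j, V j} = edge m \<or> {U j, V j} = edge (Suc m)" using idx(2) by metis
    then show "x (Suc m) \<in> {U j, V j}" by (auto simp: edge_def)
  qed
  then have "incidence_sum n (x (Suc m)) = (\<Sum>j<n. if j = idx m \<or> j = idx (Suc m) then j else 0)"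
    unfolding incidence_sum_def by (intro sum.cong) auto
  also have "\<dots> = \<Sum>({..<n} \<inter> {j. j = idx m \<or> j = idx (Suc m)})"
    by (simp add: sum.inter_restrict)
  also have "{..<n} \<inter> {j. j = idx m \<or> j = idx (Suc m)} = {idx m, idx (Suc m)}"
    using idx(1) by auto
  also have "\<Sum>{idx m, idx (Suc m)} = idx m + idx (Suc m)"
    using idx(2)[of m] idx(2)[of "Suc m"] edge_neq_Suc[of m] by (subst sum.insert) auto
  finally show ?thesis .
qed

lemma incidence_sum_le:
  assumes "v < n" "k \<le> n"
  shows "incidence_sum k v \<le> 2 * n"
proof -
  obtain t where t: "v = x t" using assms(1) range_x by (metis lessThan_iff rangeE)
  \<comment> \<open>The period supplies a successor index, as the formula for the full sum
    requires.\<close>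
  then have "v = x (Suc (t + n - 1))" using x_period[of t] n_ge_3 by simp
  then have "incidence_sum n v \<le> 2 * n"
    using incidence_sum_full[of "t + n - 1"] idx(1)[of "t + n - 1"] idx(1)[of "Suc (t + n - 1)"] by simp
  moreover have "incidence_sum k v \<le> incidence_sum n v"
    unfolding incidence_sum_def using assms(2) by (intro sum_mono2) auto
  ultimately show ?thesis by simp
qed

lemma incidence_sum_Suc:
  "incidence_sum (Suc k) = (\<lambda>v. incidence_sum k v + (if v = U k \<or> v = V k then k else 0))"
  by (auto simp: incidence_sum_def)

lemma prefix_weight_diff:
  "prefix_weight (i + 2 * k) - prefix_weight i = (\<Sum>j<k. w (edge (i + 2 * j)))"
  by (induction k) simp_all

section \<open>Invariants of the loops\<close>

lemma wp_incidence_loop: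
  assumes s: "ivar s 0 = n" "ivar s 1 = n" "ivar s 3 = 0" "ivar s 6 = 0" "ivar s 7 = 0"
      "iarr s 0 = U" "iarr s 1 = V" "iarr s 2 = (\<lambda>_. 0)" "iarr s 3 = (\<lambda>_. 0)" "iarr s 5 = (\<lambda>_. 0)"
      "rarr s 0 = W" "rarr s 1 = (\<lambda>_. 0)"
    and Q: "\<And>t s'. t \<le> (n + 1) * 100 \<Longrightarrow>
      ivar s' 0 = n \<Longrightarrow> ivar s' 3 = 0 \<Longrightarrow> ivar s' 6 = 0 \<Longrightarrow> ivar s' 7 = 0 \<Longrightarrow>
      iarr s' 0 = U \<Longrightarrow> iarr s' 1 = V \<Longrightarrow> iarr s' 2 = (\<lambda>_. 0) \<Longrightarrow> iarr s' 3 = incidence_sum n \<Longrightarrow>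
      iarr s' 5 = (\<lambda>_. 0) \<Longrightarrow> rarr s' 0 = W \<Longrightarrow> rarr s' 1 = (\<lambda>_. 0) \<Longrightarrow> Q t s'"
  shows "wp L incidence_loop s Q"
proof -
  define I where "I k s' \<longleftrightarrow> ivar s' 0 = n \<and> ivar s' 1 = n \<and> ivar s' 2 = k \<and> ivar s' 3 = 0 \<and>
    ivar s' 6 = 0 \<and> ivar s' 7 = 0 \<and> iarr s' 0 = U \<and> iarr s' 1 = V \<and> iarr s' 2 = (\<lambda>_. 0) \<and>
    iarr s' 3 = incidence_sum k \<and> iarr s' 5 = (\<lambda>_. 0) \<and> rarr s' 0 = W \<and> rarr s' 1 = (\<lambda>_. 0)"
    for k and s' :: state
  show ?thesis
    unfolding incidence_loop_def
  proof (rule wp_for_loop[where I = I and N = n and B = 50])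
    show "I 0 (s\<lparr>ivar := (ivar s)(2 := 0)\<rparr>)"
      using s by (simp add: I_def incidence_sum_def fun_eq_iff)
  next
    fix k s' assume k: "k < n" and I: "I k s'"
    have "incidence_sum k (U k) \<le> 2 * n" "incidence_sum k (V k) \<le> 2 * n" "U k < n" "V k < n" "U k \<noteq> V k"
      using incidence_sum_le UV_less U_neq_V k by simp_all
    then show "wp L
          (Seq (IStore 3 (IArr 0 (IVar 2)) (IAdd (IArr 3 (IArr 0 (IVar 2))) (IVar 2)))
               (IStore 3 (IArr 1 (IVar 2)) (IAdd (IArr 3 (IArr 1 (IVar 2))) (IVar 2)))) s'
          (\<lambda>t s''. t \<le> 50 \<and> ivar s'' 2 = k \<and> I (Suc k) (s''\<lparr>ivar := (ivar s'')(2 := Suc k)\<rparr>))"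
      using I k L_ge by (simp add: I_def wp_simps incidence_sum_Suc fun_eq_iff)
  qed (use L_ge Q in \<open>simp_all add: I_def\<close>)
qed

text \<open>Before iteration \<open>k\<close>, words 3 and 4 hold the position of
  \<open>edge k\<close> and its far end. Subtracting them from the incidence sum and then the
  endpoint sum advances the walk.\<close>

lemma wp_walk_loop:
  assumes s: "ivar s 0 = n" "ivar s 3 = 0" "ivar s 4 = V 0" "ivar s 6 = 0" "ivar s 7 = 0"
      "iarr s 0 = U" "iarr s 1 = V" "iarr s 2 = (\<lambda>_. 0)" "iarr s 3 = incidence_sum n"
      "iarr s 5 = (\<lambda>_. 0)" "rarr s 0 = W" "rarr s 1 = (\<lambda>_. 0)"
    and Q: "\<And>t s'. t \<le> (2 * n + 1) * 100 \<Longrightarrow>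
      ivar s' 0 = n \<Longrightarrow> ivar s' 6 = 0 \<Longrightarrow> ivar s' 7 = 0 \<Longrightarrow>
      iarr s' 2 = (\<lambda>_. 0) \<Longrightarrow> (\<And>j. j < 2 * n \<Longrightarrow> iarr s' 4 j = idx j) \<Longrightarrow>
      iarr s' 5 = (\<lambda>_. 0) \<Longrightarrow> (\<And>j. j < 2 * n + 2 \<Longrightarrow> rarr s' 1 j = prefix_weight j) \<Longrightarrow> Q t s'"
  shows "wp L walk_loop s Q"
proof -
  define I where "I k s' \<longleftrightarrow> ivar s' 0 = n \<and> ivar s' 2 = k \<and> ivar s' 3 = idx k \<and> ivar s' 4 = x (Suc k) \<and>
    ivar s' 6 = 0 \<and> ivar s' 7 = 0 \<and> iarr s' 0 = U \<and> iarr s' 1 = V \<and> iarr s' 2 = (\<lambda>_. 0) \<and>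
    iarr s' 3 = incidence_sum n \<and> (\<forall>j<k. iarr s' 4 j = idx j) \<and> iarr s' 5 = (\<lambda>_. 0) \<and>
    rarr s' 0 = W \<and> (\<forall>j<k + 2. rarr s' 1 j = prefix_weight j)"
    for k and s' :: state
  show ?thesis
    unfolding walk_loop_def
  proof (rule wp_for_loop[where I = I and N = "2 * n" and B = 50])
    \<comment> \<open>The two base values are the zeros already present in real array 1.\<close>
    have "prefix_weight j = 0" if "j < 2" for j
      using that by (cases j rule: prefix_weight.cases) auto
    moreover have "V 0 = x (Suc 0)" using x_1 length_es n_ge_3 by (auto simp: V_def)
    ultimately show "I 0 (s\<lparr>ivar := (ivar s)(2 := 0)\<rparr>)"
      using s by (simp add: I_def idx_0)
  next
    fix k s' assume k: "k < 2 * n" and I: "I k s'"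
    have bounds: "idx k < n" "idx (Suc k) < n" "x k < n" "x (Suc k) < n" "x (Suc (Suc k)) < n"
      using idx(1) x_less by simp_all
    have "U (idx (Suc k)) < n" "V (idx (Suc k)) < n" using UV_less idx(1) by simp_all
    moreover have "incidence_sum n (x (Suc k)) = idx k + idx (Suc k)" by (rule incidence_sum_full)
    moreover have "U (idx (Suc k)) + V (idx (Suc k)) - x (Suc k) = x (Suc (Suc k))"
      using UV_idx_sum[of "Suc k"] by simp
    moreover have "W (idx k) = w (edge k)" by (rule W_idx)
    ultimately show "wp L
          (Seq (IStore 4 (IVar 2) (IVar 3))
          (Seq (RStore 1 (IAdd (IVar 2) (IConst 2)) (RAdd (RArr 1 (IVar 2)) (RArr 0 (IVar 3))))
          (Seq (IAssign 3 (ISub (IArr 3 (IVar 4)) (IVar 3)))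
               (IAssign 4 (ISub (IAdd (IArr 0 (IVar 3)) (IArr 1 (IVar 3))) (IVar 4)))))) s'
          (\<lambda>t s''. t \<le> 50 \<and> ivar s'' 2 = k \<and> I (Suc k) (s''\<lparr>ivar := (ivar s'')(2 := Suc k)\<rparr>))"
      using I k L_ge bounds by (simp add: I_def wp_simps less_Suc_eq)
  qed (use L_ge Q in \<open>simp_all add: I_def\<close>)
qed

lemma wp_mark_loop:
  assumes s: "ivar s 6 \<le> ivar s 7" "ivar s 7 \<le> 2 * n" "iarr s 2 = (\<lambda>_. 0)"
      "\<And>j. j < 2 * n \<Longrightarrow> iarr s 4 j = idx j"
    and Q: "\<And>t s'. t \<le> (n + 1) * 100 \<Longrightarrow>
      output_edges es s' = chain (ivar s 6) ((ivar s 7 - ivar s 6) div 2) \<Longrightarrow> Q t s'"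
  shows "wp L mark_loop s Q"
proof -
  define b where "b = ivar s 6"
  define N where "N = (ivar s 7 - ivar s 6) div 2"
  have bN: "b + 2 * N \<le> 2 * n" and N: "N \<le> n" using s unfolding b_def N_def by auto
  define I where "I k s' \<longleftrightarrow> ivar s' 2 = k \<and> ivar s' 6 = b \<and> ivar s' 7 = ivar s 7 \<and>
    iarr s' 4 = iarr s 4 \<and> (\<forall>p. iarr s' 2 p = (if \<exists>j<k. p = idx (b + 2 * j) then 1 else 0))"
    for k and s' :: state
  \<comment> \<open>The ones in array 2 sit at the positions of the chain edges;
    \<open>idx(2)\<close> translates positions back to edges.\<close>
  have out: "output_edges es s' = chain b N" if "I N s'" for s'
  proof -
    have "output_edges es s' = {{U p, V p} | p. p < n \<and> (\<exists>j<N. p = idx (b + 2 * j))}"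
      using that length_es unfolding output_edges_def I_def U_def V_def by auto
    also have "\<dots> = {{U (idx (b + 2 * j)), V (idx (b + 2 * j))} | j. j < N}"
      using idx(1) by blast
    also have "\<dots> = chain b N"
      unfolding idx(2) chain_def by blast
    finally show ?thesis .
  qed
  show ?thesis
    unfolding mark_loop_def
  proof (rule wp_for_loop[where I = I and N = N and B = 50])
    show "I 0 (s\<lparr>ivar := (ivar s)(2 := 0)\<rparr>)"
      using s by (simp add: I_def b_def)
  next
    fix k s' assume k: "k < N" and I: "I k s'"
    have "b + 2 * k < 2 * n" using k bN by simp
    moreover from this have "iarr s 4 (b + 2 * k) = idx (b + 2 * k)" using s(4) by simp
    moreover have "idx (b + 2 * k) < n" by (rule idx(1))
    ultimately show "wp L (IStore 2 (IArr 4 (IAdd (IVar 6) (IAdd (IVar 2) (IVar 2)))) (IConst 1)) s'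
          (\<lambda>t s''. t \<le> 50 \<and> ivar s'' 2 = k \<and> I (Suc k) (s''\<lparr>ivar := (ivar s'')(2 := Suc k)\<rparr>))"
      using I k L_ge by (auto simp: I_def wp_simps less_Suc_eq mult_2[symmetric])
  next
    fix t s' assume t: "t \<le> (N + 1) * (50 + icost (IDiv (ISub (IVar 7) (IVar 6)) (IConst 2)) + 8)"
      and I: "I N s'"
    have "(N + 1) * 63 \<le> (n + 1) * 100" using N by simp
    with t have "t \<le> (n + 1) * 100" by simp
    then show "Q t s'" using out[OF I] by (intro Q) (simp_all add: b_def N_def)
  qed (use L_ge s N in \<open>auto simp: I_def N_def b_def\<close>)
qed

section \<open>Optimality of the computed chain\<close>

text \<open>Connected matchings are chains, and chain weights are differences of prefix weights, so
  a best pair of indices gives a best matching.\<close>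

lemma optimal_chain:
  assumes H: "H = 2 * (n div 2)"
    and b: "b \<le> b'" "even (b' - b)" "b' - b \<le> H"
    and best: "\<And>i j. i \<le> H \<Longrightarrow> i \<le> j \<Longrightarrow> even (j - i) \<Longrightarrow> j - i \<le> H \<Longrightarrow>
      prefix_weight j - prefix_weight i \<le> prefix_weight b' - prefix_weight b"
  shows "max_weight_connected_matching E w (chain b ((b' - b) div 2))"
proof -
  have Hn: "H \<le> n" using H by simp
  have b': "b + 2 * ((b' - b) div 2) = b'" "2 * ((b' - b) div 2) \<le> n" using b Hn by simp_all
  have "sum w M \<le> sum w (chain b ((b' - b) div 2))" if M: "connected_matching E M" for M
  proof -
    obtain i k where ik: "i < n" "2 * k \<le> n" "M = chain i k"
      using connected_matching_is_chain[OF M] by blast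
    \<comment> \<open>\<open>n \<le> H + 1\<close> bounds the start, and \<open>2 * k\<close> is
      even.\<close>
    have "i \<le> H" "2 * k \<le> H" using ik(1,2) H by presburger+
    then have "prefix_weight (i + 2 * k) - prefix_weight i \<le> prefix_weight b' - prefix_weight b"
      using best[of i "i + 2 * k"] by simp
    then show ?thesis
      using prefix_weight_diff[of i k] prefix_weight_diff[of b "(b' - b) div 2"] b'
      by (simp add: ik sum_chain)
  qed
  then show ?thesis
    using connected_matching_chain[OF b'(2)] by (simp add: max_weight_connected_matching_def)
qed

lemma wp_optimise:
  assumes s: "ivar s 5 = 2 * (n div 2)" "ivar s 6 = 0" "ivar s 7 = 0" "iarr s 2 = (\<lambda>_. 0)"
      "\<And>j. j < 2 * n \<Longrightarrow> iarr s 4 j = idx j" "iarr s 5 = (\<lambda>_. 0)"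
      "\<And>j. j < 2 * n + 2 \<Longrightarrow> rarr s 1 j = prefix_weight j"
    and Q: "\<And>t s'. t \<le> (n + 2) * 300 \<Longrightarrow>
      max_weight_connected_matching E w (output_edges es s') \<Longrightarrow> Q t s'"
  shows "wp L (Seq (scan_loop (IVar 2) (IVar 2))
    (Seq (scan_loop (ISub (IVar 5) (IVar 2)) (ISub (IAdd (IVar 5) (IVar 5)) (IVar 2))) mark_loop)) s Q"
proof -
  define H where "H = 2 * (n div 2)"
  \<comment> \<open>\<open>C\<close> holds the pairs that encode chains within the computed prefix
    weights; the initial pair \<open>(0, 0)\<close> is the empty matching.\<close>
  define C where "C = {(i, j). i \<le> j \<and> even (j - i) \<and> j - i \<le> H \<and> j \<le> 2 * H}"
  let ?q = "rarr s 1"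
  have H: "H \<le> n" "even H" "2 * H + 2 \<le> L" "H + H \<le> L" using L_ge by (simp_all add: H_def)
  have C: "C \<subseteq> {(i, j). i \<le> L \<and> j \<le> L}" using H by (auto simp: C_def)
  have q: "?q j = prefix_weight j" if "j \<le> 2 * H" for j
    using s that H(1) by simp
  show ?thesis
    unfolding wp_simps(6)
  proof (rule wp_scan_loop[where q = ?q and G = "\<lambda>y. y" and K = "\<lambda>y. y" and C = C and H = H],
      goal_cases)
    case (11 t1 s1)
    show ?case
    proof (rule wp_scan_loop[where q = ?q and G = "\<lambda>y. H - y" and K = "\<lambda>y. H + H - y"
          and C = C and H = H], goal_cases)
      case (5 y z)
      \<comment> \<open>In the second scan the distance is at most \<open>H\<close> automatically,
        and even because \<open>H\<close> is.\<close>
      then have "H + H - y - (H - z) = H - (y - z)" by simp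
      then show ?case using 5 H(2) by (auto simp: C_def)
    next
      case (11 t2 s2)
      note improve = \<open>?q (ivar s1 7) - ?q (ivar s1 6) \<le> ?q (ivar s2 7) - ?q (ivar s2 6)\<close>
        and first = \<open>\<And>y z. z \<le> y \<Longrightarrow> y \<le> H \<Longrightarrow> even (y - z) \<Longrightarrow>
          ?q y - ?q z \<le> ?q (ivar s1 7) - ?q (ivar s1 6)\<close>
        and second = \<open>\<And>y z. z \<le> y \<Longrightarrow> y \<le> H \<Longrightarrow> even (y - z) \<Longrightarrow>
          ?q (H + H - y) - ?q (H - z) \<le> ?q (ivar s2 7) - ?q (ivar s2 6)\<close>
      let ?b = "ivar s2 6" and ?b' = "ivar s2 7"
      have b: "?b \<le> ?b'" "even (?b' - ?b)" "?b' - ?b \<le> H" "?b' \<le> 2 * H"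
        using \<open>(ivar s2 6, ivar s2 7) \<in> C\<close> by (auto simp: C_def)
      have best: "prefix_weight j - prefix_weight i \<le> prefix_weight ?b' - prefix_weight ?b"
        if ij: "i \<le> H" "i \<le> j" "even (j - i)" "j - i \<le> H" for i j
      proof -
        have "?q j - ?q i \<le> ?q ?b' - ?q ?b"
        \<comment> \<open>Ends up to \<open>H\<close> were seen by the first scan. Later ones appear
          in the second at \<open>y = 2 * H - j\<close> and \<open>z = H - i\<close>, where
          \<open>z \<le> y\<close> is the length bound \<open>j - i \<le> H\<close>.\<close>
        proof (cases "j \<le> H")
          case True
          then show ?thesis using first[of i j] ij improve by simp
        next
          case False
          have z: "H - i \<le> H + H - j" "H + H - j \<le> H" "H + H - j - (H - i) = H - (j - i)"
            using ij False by auto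
          have "?q (H + H - (H + H - j)) - ?q (H - (H - i)) \<le> ?q ?b' - ?q ?b"
            using z ij H(2) by (intro second) auto
          moreover have "H + H - (H + H - j) = j" "H - (H - i) = i" using ij by auto
          ultimately show ?thesis by simp
        qed
        then show ?thesis using q[of i] q[of j] q[of ?b] q[of ?b'] ij b by simp
      qed
      show ?case
      proof (rule wp_mark_loop, goal_cases)
        case 1 show ?case using b(1) .
      next
        case 2 show ?case using b(4) H(1) by simp
      next
        case 3 show ?case using \<open>iarr s2 2 = iarr s1 2\<close> \<open>iarr s1 2 = iarr s 2\<close> s(4) by simp
      next
        case (4 j)
        then show ?case using \<open>iarr s2 4 = iarr s1 4\<close> \<open>iarr s1 4 = iarr s 4\<close> s(5) by simp
      next
        case (5 t3 s3)
        have "t1 + (t2 + t3) \<le> (n + 2) * 300"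
          using \<open>t1 \<le> (H + 2) * 100\<close> \<open>t2 \<le> (H + 2) * 100\<close> 5(1) H(1) by simp
        moreover have "max_weight_connected_matching E w (output_edges es s3)"
          unfolding 5(2) using optimal_chain[OF H_def b(1-3) best] by blast
        ultimately show ?case by (rule Q)
      qed
    qed (use 11 H C in simp_all)
  qed (use s H C in \<open>simp_all add: C_def flip: H_def\<close>)
qed

lemma wp_cycle_program:
  "wp L cycle_program (input_state n es w)
     (\<lambda>t s. t \<le> 1000 * (n + n) \<and> max_weight_connected_matching E w (output_edges es s))"
  unfolding cycle_program_def
proof (rule wp_simps(6)[THEN iffD2], rule wp_incidence_loop, goal_cases)
  case (13 t1 s1)
  have "V 0 \<le> L" using UV_less(2)[of 0] n_ge_3 L_ge by simp
  then show ?case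
    unfolding wp_simps(6)[of L "IAssign _ _"] wp_simps(2)
  proof (intro conjI, goal_cases)
    case 1
    then show ?case using 13 by simp
  next
    case 2
    show ?case
    proof (rule wp_simps(6)[THEN iffD2], rule wp_walk_loop, goal_cases)
      case (13 t2 s2)
      have "2 * (n div 2) \<le> n" by simp
      then have fit: "ifits L s2 (IMul (IConst 2) (IDiv (IVar 0) (IConst 2)))"
        using 13 L_ge by simp
      show ?case
        unfolding wp_simps(6)[of L "IAssign _ _"] wp_simps(2)
      proof (intro conjI fit, rule wp_optimise, goal_cases)
        \<comment> \<open>The loops and the two assignments take at most
          \<open>600 * n + 809\<close> units, below \<open>2000 * n\<close> for
          \<open>n \<ge> 3\<close>.\<close>
        case (8 t3 s3)
        then show ?case using \<open>t1 \<le> (n + 1) * 100\<close> \<open>t2 \<le> (2 * n + 1) * 100\<close> n_ge_3 by simp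
      qed (use 13 in simp_all)
    qed (use 13 in simp_all)
  qed
qed (simp_all add: input_state_def length_es U_def V_def W_def fun_eq_iff)

end

theorem theorem4:
  "\<exists>(P :: com) (c :: nat).
     \<forall>(n :: nat) (E :: nat set set) (w :: nat set \<Rightarrow> real) (es :: (nat \<times> nat) list).
       simple_graph {..<n} E \<longrightarrow> cycle_graph {..<n} E \<longrightarrow> edge_list E es \<longrightarrow>
       (\<exists>t s. exec (c * (n + length es)) P (input_state n es w) t s \<and>
              t \<le> c * (n + length es) \<and>
              max_weight_connected_matching E w (output_edges es s))"
proof (rule exI[of _ cycle_program], rule exI[of _ 1000], intro allI impI)
  fix n E w es
  assume cyc: "cycle_graph {..<n} E" and es: "edge_list E es"
  \<comment> \<open>A first listed edge must exist: it fixes the start and direction of the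
    walk.\<close>
  have "E \<noteq> {}"
  proof -
    obtain vs where "length vs \<ge> 3" "E = {{vs ! i, vs ! (Suc i mod length vs)} | i. i < length vs}"
      using cyc unfolding cycle_graph_def by blast
    then show ?thesis by (auto intro!: exI[of _ 0])
  qed
  then have "es \<noteq> []" using es by (auto simp: edge_list_def)
  then have "{fst (es ! 0), snd (es ! 0)} \<in> E"
    using es by (cases es) (auto simp: edge_list_def split: prod.splits)
  then obtain x where x: "cyclic_walk n x E" "range x = {..<n}" "x 0 = fst (es ! 0)" "x 1 = snd (es ! 0)"
    using cyclic_walk_exists[OF cyc] unfolding card_lessThan by blast
  interpret cyclic_walk n x E by (rule x(1))
  \<comment> \<open>The word bound \<open>2000 * n\<close> is at least \<open>4 * n + 4\<close> by
    \<open>n \<ge> 3\<close>.\<close>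
  interpret cycle_input n x E es w "1000 * (n + n)"
    using x es n_ge_3 by unfold_locales simp_all
  show "\<exists>t s. exec (1000 * (n + length es)) cycle_program (input_state n es w) t s \<and>
      t \<le> 1000 * (n + length es) \<and> max_weight_connected_matching E w (output_edges es s)"
    using wp_cycle_program unfolding wp_def length_es by blast
qed

end
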